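(* Let $p\ge5$ be a prime and let $U$ be the subgroup of all upper triangular matrices in $\mathrm{SL}(2,p)$. Let $H$ be a subgroup of $U$ and let $x\in\mathrm{SL}(2,p)$. If $S=H\cup\{x,x^{-1}\}$, or $x^2\in H$ and $S=H\cup(xH\cap Hx)$, and $\langle S\rangle=\mathrm{SL}(2,p)$, then $|S^3|>|S|^{3/2}$.
   Context: For a subset $S$ of a group, $S^3=\{abc: a,b,c\in S\}$. Explicitly, $U=\left\{\begin{pmatrix}\alpha&\beta\\0&\alpha^{-1}\end{pmatrix}:\alpha\in\mathbb{Z}_p^*,\ \beta\in\mathbb{Z}_p\right\}$, where $\mathbb{Z}_p=\mathbb{Z}/p\mathbb{Z}$. *)

theory Defs
  imports
    "HOL-Analysis.Determinants"
    "HOL-Algebra.Generated_Groups"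
    "Berlekamp_Zassenhaus.Finite_Field"
begin

text \<open>
  The prime field with \<open>p\<close> elements is \<open>'p mod_ring\<close> with \<open>'p :: prime_card\<close> and
  \<open>p = CARD('p)\<close>, so \<open>SL(2,p)\<close> is \<open>SL2 :: ('p mod_ring ^ 2 ^ 2) monoid\<close>.
\<close>

definition SL2 :: "('a::field ^ 2 ^ 2) monoid" where
  "SL2 = \<lparr>carrier = {A. det A = 1}, mult = (**), one = mat 1\<rparr>"

text \<open>In \<open>A $ i $ j\<close> the row index is \<open>i\<close>, so \<open>A $ 2 $ 1\<close> is the lower left entry.\<close>

definition upper_SL2 :: "('a::field ^ 2 ^ 2) set" where
  "upper_SL2 = {A \<in> carrier SL2. A $ 2 $ 1 = 0}"

lemma group_SL2: "group (SL2 :: ('a::field ^ 2 ^ 2) monoid)"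
proof (rule groupI)
  fix A :: "'a ^ 2 ^ 2"
  assume A: "A \<in> carrier SL2"
  let ?B = "vector [vector [A $ 2 $ 2, - A $ 1 $ 2], vector [- A $ 2 $ 1, A $ 1 $ 1]] :: 'a ^ 2 ^ 2"
  have "?B \<in> carrier SL2"
    using A by (simp add: SL2_def det_2 algebra_simps)
  moreover have "?B \<otimes>\<^bsub>SL2\<^esub> A = \<one>\<^bsub>SL2\<^esub>"
    using A by (simp add: SL2_def det_2 matrix_matrix_mult_def mat_def vec_eq_iff forall_2 sum_2
        algebra_simps)
  ultimately show "\<exists>B \<in> carrier SL2. B \<otimes>\<^bsub>SL2\<^esub> A = \<one>\<^bsub>SL2\<^esub>"
    by blast
qed (auto simp: SL2_def det_mul matrix_mul_assoc)

lemma upper_SL2_eq: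
  "(upper_SL2 :: ('a::field ^ 2 ^ 2) set) =
    {vector [vector [\<alpha>, \<beta>], vector [0, inverse \<alpha>]] | \<alpha> \<beta>. \<alpha> \<noteq> 0}"
proof (intro equalityI subsetI)
  fix A :: "'a ^ 2 ^ 2"
  assume "A \<in> upper_SL2"
  then have A: "A $ 1 $ 1 * A $ 2 $ 2 = 1" "A $ 2 $ 1 = 0"
    by (auto simp: upper_SL2_def SL2_def det_2)
  then have "A $ 1 $ 1 \<noteq> 0" "A $ 2 $ 2 = inverse (A $ 1 $ 1)"
    by (auto simp: inverse_unique)
  with A have "A = vector [vector [A $ 1 $ 1, A $ 1 $ 2], vector [0, inverse (A $ 1 $ 1)]]"
    by (simp add: vec_eq_iff forall_2)
  with \<open>A $ 1 $ 1 \<noteq> 0\<close>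
  show "A \<in> {vector [vector [\<alpha>, \<beta>], vector [0, inverse \<alpha>]] | \<alpha> \<beta>. \<alpha> \<noteq> 0}"
    by blast
qed (auto simp: upper_SL2_def SL2_def det_2)

lemma subgroup_upper_SL2: "subgroup (upper_SL2 :: ('a::field ^ 2 ^ 2) set) SL2"
proof (rule group.subgroupI[OF group_SL2])
  fix A :: "'a ^ 2 ^ 2"
  assume A: "A \<in> upper_SL2"
  let ?B = "vector [vector [A $ 2 $ 2, - A $ 1 $ 2], vector [0, A $ 1 $ 1]] :: 'a ^ 2 ^ 2"
  have "A \<in> carrier SL2" "?B \<in> carrier SL2"
    using A by (auto simp: upper_SL2_def SL2_def det_2 algebra_simps)
  moreover have "?B \<otimes>\<^bsub>SL2\<^esub> A = \<one>\<^bsub>SL2\<^esub>"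
    using A by (simp add: upper_SL2_def SL2_def det_2 matrix_matrix_mult_def mat_def vec_eq_iff
        forall_2 sum_2 algebra_simps)
  ultimately have "inv\<^bsub>SL2\<^esub> A = ?B"
    by (blast intro: group.inv_equality[OF group_SL2])
  with \<open>?B \<in> carrier SL2\<close> show "inv\<^bsub>SL2\<^esub> A \<in> upper_SL2"
    by (simp add: upper_SL2_def)
next
  fix A B :: "'a ^ 2 ^ 2"
  assume "A \<in> upper_SL2" "B \<in> upper_SL2"
  moreover from this have "(A ** B) $ 2 $ 1 = 0"
    by (simp add: upper_SL2_def matrix_matrix_mult_def sum_2)
  ultimately show "A \<otimes>\<^bsub>SL2\<^esub> B \<in> upper_SL2"
    by (simp add: upper_SL2_def SL2_def det_mul)
next
  show "upper_SL2 \<noteq> ({} :: ('a ^ 2 ^ 2) set)"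
    unfolding upper_SL2_eq using zero_neq_one[symmetric] by blast
qed (auto simp: upper_SL2_def)

end

theory Submission
  imports Defs
begin

text \<open>
  Since \<open>S\<close> generates, \<open>x\<close> is not upper triangular, so \<open>S\<^sup>3\<close> contains the disjoint sets \<open>H\<close> and
  \<open>HxH\<close>. Put \<open>D = H \<inter> xHx\<inverse>\<close>. Then \<open>\<bar>HxH\<bar> \<bar>D\<bar> \<ge> \<bar>H\<bar>\<^sup>2\<close>, while \<open>\<bar>S\<bar> \<le> \<bar>H\<bar> + max 2 \<bar>D\<bar>\<close>, so that
  the claim amounts to \<open>D\<close> being small: with \<open>n = \<bar>H\<bar>\<close> and \<open>k = \<bar>D\<bar> \<ge> 2\<close> it is enough that
  \<open>n\<^sup>2 > k\<^sup>2 (n + k)\<close> (\<open>growth_arith\<close>), and for \<open>k = 1\<close> that \<open>n \<ge> 3\<close>.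

  Let \<open>\<chi>\<close> be the upper left entry, a homomorphism on upper triangular matrices whose kernel is
  the group of unipotent matrices. A matrix in \<open>D\<close> that is unipotent has to be the identity,
  because its conjugate by \<open>x\<close> is upper triangular too. Hence \<open>\<chi>\<close> is injective on \<open>D\<close>. If \<open>H\<close>
  contains a unipotent matrix other than the identity, it contains all \<open>p\<close> of them, hence
  \<open>n \<ge> p \<bar>\<chi>(H)\<bar> \<ge> pk\<close> with \<open>k < p\<close>, and this is sufficient.

  Otherwise \<open>\<chi>\<close> is injective on \<open>H\<close>, and \<open>H\<close> is abelian. Here the generation hypothesis is used a
  second time, through extended centralizers: for \<open>a \<noteq> \<plusminus>1\<close> the matrices that conjugate \<open>a\<close> to
  \<open>a\<close> or \<open>a\<inverse>\<close> form a proper subgroup, which thus cannot contain both \<open>H\<close> and \<open>x\<close>. If \<open>d \<in> D\<close>, then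
  \<open>d\<close> and \<open>x\<inverse>dx\<close> both lie in \<open>H\<close> and have the same eigenvalues, so that \<open>x\<inverse>dx\<close> is \<open>d\<close> or \<open>d\<inverse>\<close>, and
  \<open>x\<close> lies in the extended centralizer of \<open>d\<close>, as \<open>H\<close> does. This gives \<open>D \<subseteq> {1, -1}\<close>, and in the same
  way \<open>H\<close> is not contained in \<open>{1, -1}\<close>. The bounds above then suffice unless \<open>H = {\<plusminus>1, \<plusminus>g}\<close> with
  \<open>g\<^sup>2 = -1\<close>, where they give only \<open>\<bar>S\<^sup>3\<bar> \<ge> 12\<close> against \<open>\<bar>S\<bar> \<le> 6\<close>. In that case \<open>xgx\<inverse>\<close>, \<open>-xgx\<inverse>\<close> and
  \<open>xgx\<close> are three further elements of \<open>S\<^sup>3\<close> (\<open>order_four_extra_elements\<close>), and \<open>15\<^sup>2 > 6\<^sup>3\<close>. If they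
  were not new and distinct, then \<open>\<langle>g, x\<rangle>\<close> would modulo \<open>\<plusminus>1\<close> be an abelian or a dihedral group.
\<close>

section \<open>Double cosets and extended centralizers\<close>

context group
begin

lemma left_cancel_eq:
  "\<lbrakk>a \<in> carrier G; b \<in> carrier G; c \<in> carrier G\<rbrakk> \<Longrightarrow> a \<otimes> b = a \<otimes> c \<longleftrightarrow> b = c"
  by simp

lemma inv_mult_cancel: "\<lbrakk>a \<in> carrier G; b \<in> carrier G\<rbrakk> \<Longrightarrow> inv a \<otimes> (a \<otimes> b) = b"
  by (simp flip: m_assoc)

lemma conjugate_intersection_subgroup:
  assumes H: "subgroup H G" and x: "x \<in> carrier G"
  shows "subgroup {d \<in> H. inv x \<otimes> d \<otimes> x \<in> H} G"
proof (rule subgroupI)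
  note closed = subgroup.mem_carrier[OF H]
  have cancel: "x \<otimes> (inv x \<otimes> c) = c" if "c \<in> carrier G" for c
    using inv_mult_cancel[of "inv x" c] x that by simp
  show "{d \<in> H. inv x \<otimes> d \<otimes> x \<in> H} \<subseteq> carrier G"
    using closed by auto
  show "{d \<in> H. inv x \<otimes> d \<otimes> x \<in> H} \<noteq> {}"
    using subgroup.one_closed[OF H] x by (auto intro: exI[of _ \<one>])
  fix d assume d: "d \<in> {d \<in> H. inv x \<otimes> d \<otimes> x \<in> H}"
  have "inv x \<otimes> inv d \<otimes> x = inv (inv x \<otimes> d \<otimes> x)"
    using d x closed by (simp add: inv_mult_group m_assoc)
  then show "inv d \<in> {d \<in> H. inv x \<otimes> d \<otimes> x \<in> H}"
    using d H by (simp add: subgroup.m_inv_closed)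
  fix e assume e: "e \<in> {d \<in> H. inv x \<otimes> d \<otimes> x \<in> H}"
  have "inv x \<otimes> (d \<otimes> e) \<otimes> x = (inv x \<otimes> d \<otimes> x) \<otimes> (inv x \<otimes> e \<otimes> x)"
    using d e x closed by (simp add: m_assoc cancel)
  then show "d \<otimes> e \<in> {d \<in> H. inv x \<otimes> d \<otimes> x \<in> H}"
    using d e H by (simp add: subgroup.m_closed)
qed

lemma subgroup_double_coset_disjoint:
  assumes H: "subgroup H G" and x: "x \<in> carrier G" "x \<notin> H"
  shows "H \<inter> (H <#> (x <#\<^bsub>G\<^esub> H)) = {}"
proof (rule ccontr)
  assume "\<not> ?thesis"
  then obtain a b where ab: "a \<in> H" "b \<in> H" "a \<otimes> (x \<otimes> b) \<in> H"
    by (auto simp: set_mult_def l_coset_def)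
  have "inv a \<otimes> (a \<otimes> (x \<otimes> b)) \<otimes> inv b \<in> H"
    using ab by (intro subgroup.m_closed[OF H, OF subgroup.m_closed[OF H]] subgroup.m_inv_closed[OF H])
  moreover have "inv a \<otimes> (a \<otimes> (x \<otimes> b)) \<otimes> inv b = x"
    using ab x(1) subgroup.mem_carrier[OF H] by (simp add: inv_mult_cancel m_assoc)
  ultimately show False using x(2) by simp
qed

text \<open>
  The pairs \<open>(a, b)\<close> with a given product \<open>axb\<close> differ from one of them, \<open>(r, c)\<close> say, by
  \<open>r\<inverse>a = xcb\<inverse>x\<inverse>\<close>, an element of \<open>H \<inter> xHx\<inverse>\<close> that determines the pair.
\<close>

lemma card_double_coset:
  assumes "finite H" "subgroup H G" "x \<in> carrier G"
  shows "card H * card H \<le> card (H <#> (x <#\<^bsub>G\<^esub> H)) * card {d \<in> H. inv x \<otimes> d \<otimes> x \<in> H}"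
proof -
  let ?D = "{d \<in> H. inv x \<otimes> d \<otimes> x \<in> H}"
  have sub: "H \<subseteq> carrier G"
    using assms(2) by (rule subgroup.subset)
  have dc: "H <#> (x <#\<^bsub>G\<^esub> H) = (\<lambda>(a, b). a \<otimes> (x \<otimes> b)) ` (H \<times> H)"
    by (auto simp: set_mult_def l_coset_def)
  have fin: "finite (H <#> (x <#\<^bsub>G\<^esub> H))"
    unfolding dc using assms(1) by simp
  have "\<forall>w \<in> H <#> (x <#\<^bsub>G\<^esub> H). \<exists>a. a \<in> H \<and> (\<exists>b \<in> H. w = a \<otimes> (x \<otimes> b))"
    unfolding dc by auto
  \<comment> \<open>\<open>r w\<close> is the left factor of one chosen factorization of \<open>w\<close>\<close>
  then obtain r where r: "\<And>w. w \<in> H <#> (x <#\<^bsub>G\<^esub> H) \<Longrightarrow> r w \<in> H \<and> (\<exists>b \<in> H. w = r w \<otimes> (x \<otimes> b))"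
    by metis
  let ?f = "\<lambda>(a, b). (a \<otimes> (x \<otimes> b), inv (r (a \<otimes> (x \<otimes> b))) \<otimes> a)"
  have "card (H \<times> H) \<le> card ((H <#> (x <#\<^bsub>G\<^esub> H)) \<times> ?D)"
  proof (rule card_inj_on_le[of ?f])
    show "inj_on ?f (H \<times> H)"
    proof (rule inj_onI, clarify)
      fix a b a' b'
      assume in_H: "a \<in> H" "b \<in> H" "a' \<in> H" "b' \<in> H"
        and eq: "a \<otimes> (x \<otimes> b) = a' \<otimes> (x \<otimes> b')"
          "inv (r (a \<otimes> (x \<otimes> b))) \<otimes> a = inv (r (a' \<otimes> (x \<otimes> b'))) \<otimes> a'"
      have "a \<otimes> (x \<otimes> b) \<in> H <#> (x <#\<^bsub>G\<^esub> H)"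
        unfolding dc using in_H by force
      then have "r (a \<otimes> (x \<otimes> b)) \<in> carrier G"
        using r sub by (meson subsetD)
      moreover have C: "a \<in> carrier G" "b \<in> carrier G" "a' \<in> carrier G" "b' \<in> carrier G"
        using in_H sub by auto
      moreover have "inv (r (a \<otimes> (x \<otimes> b))) \<otimes> a = inv (r (a \<otimes> (x \<otimes> b))) \<otimes> a'"
        using eq by simp
      ultimately have "a = a'"
        by (simp add: left_cancel_eq)
      with eq(1) C assms(3) show "a = a' \<and> b = b'"
        by (simp add: left_cancel_eq)
    qed
    show "?f ` (H \<times> H) \<subseteq> (H <#> (x <#\<^bsub>G\<^esub> H)) \<times> ?D"
    proof clarify
      fix a b
      assume ab: "a \<in> H" "b \<in> H"
      let ?w = "a \<otimes> (x \<otimes> b)"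
      have w: "?w \<in> H <#> (x <#\<^bsub>G\<^esub> H)"
        unfolding dc using ab by force
      then obtain c where c: "r ?w \<in> H" "c \<in> H" "?w = r ?w \<otimes> (x \<otimes> c)"
        using r by blast
      have C: "a \<in> carrier G" "b \<in> carrier G" "c \<in> carrier G" "r ?w \<in> carrier G"
        using ab c sub by auto
      have "inv (r ?w) \<otimes> (a \<otimes> (x \<otimes> b)) = x \<otimes> c"
        using C assms(3) c(3) by (metis inv_solve_left m_closed)
      then have "inv (r ?w) \<otimes> a \<otimes> x \<otimes> b = x \<otimes> c"
        using C assms(3) by (simp add: m_assoc)
      then have "inv x \<otimes> (inv (r ?w) \<otimes> a \<otimes> x) = c \<otimes> inv b"
        using C assms(3) by (metis inv_closed inv_solve_left' inv_solve_right m_assoc m_closed)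
      then have "inv x \<otimes> (inv (r ?w) \<otimes> a) \<otimes> x = c \<otimes> inv b"
        using C assms(3) by (simp add: m_assoc)
      then have "inv x \<otimes> (inv (r ?w) \<otimes> a) \<otimes> x \<in> H"
        using ab c assms(2) by (simp add: subgroup.m_closed subgroup.m_inv_closed)
      with w show "?w \<in> H <#> (x <#\<^bsub>G\<^esub> H) \<and> inv (r ?w) \<otimes> a \<in> ?D"
        using ab c assms(2) by (simp add: subgroup.m_closed subgroup.m_inv_closed)
    qed
  qed (use assms(1) fin in auto)
  then show ?thesis
    by (simp add: card_cartesian_product)
qed

text \<open>
  In \<open>SL2\<close>, for \<open>a\<close> a noncentral diagonal matrix, this is the normalizer of the diagonal torus.
\<close>

definition extended_centralizer :: "'a \<Rightarrow> 'a set" where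
  "extended_centralizer a = {g \<in> carrier G. g \<otimes> a = a \<otimes> g \<or> g \<otimes> a = inv a \<otimes> g}"

lemma extended_centralizer_subgroup:
  assumes a: "a \<in> carrier G"
  shows "subgroup (extended_centralizer a) G"
proof -
  have swap: "g \<otimes> inv c = inv b \<otimes> g" if "g \<otimes> c = b \<otimes> g" "g \<in> carrier G" "b \<in> carrier G" "c \<in> carrier G" for b c g
    using that by (metis inv_closed inv_solve_left inv_solve_right m_assoc m_closed)
  have flip: "inv g \<otimes> b = c \<otimes> inv g" if "g \<otimes> c = b \<otimes> g" "g \<in> carrier G" "b \<in> carrier G" "c \<in> carrier G" for b c g
    using that by (metis inv_closed inv_solve_left inv_solve_right m_assoc m_closed)
  show ?thesis
  proof (rule subgroupI)
    show "extended_centralizer a \<noteq> {}"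
      using a by (auto simp: extended_centralizer_def intro: exI[of _ a])
    fix g assume g: "g \<in> extended_centralizer a"
    then have gc: "g \<in> carrier G" by (simp add: extended_centralizer_def)
    from g consider "g \<otimes> a = a \<otimes> g" | "g \<otimes> a = inv a \<otimes> g"
      by (auto simp: extended_centralizer_def)
    then show "inv g \<in> extended_centralizer a"
    proof cases
      case 1
      with flip[OF 1] a gc show ?thesis by (simp add: extended_centralizer_def)
    next
      case 2
      then have "g \<otimes> inv a = a \<otimes> g"
        using swap[OF 2] a gc by simp
      from flip[OF this] a gc show ?thesis by (simp add: extended_centralizer_def)
    qed
    fix h assume h: "h \<in> extended_centralizer a"
    then have hc: "h \<in> carrier G" by (simp add: extended_centralizer_def)
    obtain b where b: "b \<in> {a, inv a}" "h \<otimes> a = b \<otimes> h"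
      using h by (auto simp: extended_centralizer_def)
    obtain c where c: "c \<in> {a, inv a}" "g \<otimes> b = c \<otimes> g"
      using g b(1) swap[of g a a] swap[of g a "inv a"] a gc
      by (auto simp: extended_centralizer_def)
    have bc: "b \<in> carrier G" "c \<in> carrier G"
      using a b(1) c(1) by auto
    have "g \<otimes> h \<otimes> a = g \<otimes> b \<otimes> h"
      using a bc gc hc b(2) by (simp add: m_assoc)
    also have "\<dots> = c \<otimes> (g \<otimes> h)"
      using a bc gc hc c(2) by (simp add: m_assoc)
    finally show "g \<otimes> h \<in> extended_centralizer a"
      using c(1) gc hc by (auto simp: extended_centralizer_def)
  qed (auto simp: extended_centralizer_def)
qed

end

text \<open>
  The model is \<open>SL2\<close> over a field of characteristic other than two with \<open>z = -1\<close>. An element whose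
  square is \<open>z\<close> is an involution modulo \<open>{1, z}\<close>; this replaces computations in the quotient group.
\<close>

locale central_involution = group +
  fixes z
  assumes z_closed: "z \<in> carrier G"
    and z_central: "g \<in> carrier G \<Longrightarrow> g \<otimes> z = z \<otimes> g"
    and z_neq_one: "z \<noteq> \<one>"
    and z_sq: "z \<otimes> z = \<one>"
    and square_one: "\<lbrakk>g \<in> carrier G; g \<otimes> g = \<one>\<rbrakk> \<Longrightarrow> g = \<one> \<or> g = z"
    and extended_centralizer_proper:
      "\<lbrakk>a \<in> carrier G; a \<noteq> \<one>; a \<noteq> z\<rbrakk> \<Longrightarrow> extended_centralizer a \<noteq> carrier G"
begin

text \<open>
  Modulo \<open>{1, z}\<close> two involutions generate a dihedral group, in which each of them inverts the
  product \<open>ab\<close>. The computation shows that they invert it exactly, so that both lie in the extended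
  centralizer of \<open>ab\<close>, or of \<open>a\<close> when \<open>ab\<close> is central.
\<close>

lemma two_projective_involutions_not_generating:
  assumes a: "a \<in> carrier G" "a \<otimes> a = z" and b: "b \<in> carrier G" "b \<otimes> b = z"
  obtains K where "subgroup K G" "K \<noteq> carrier G" "a \<in> K" "b \<in> K"
proof (cases "a \<otimes> b = \<one> \<or> a \<otimes> b = z")
  case True
  have "b \<otimes> a = a \<otimes> b"
  proof (cases "a \<otimes> b = \<one>")
    case True
    with a b show ?thesis by (metis inv_comm)
  next
    case False
    with True a have "a \<otimes> b = a \<otimes> a" by simp
    then have "b = a" using a(1) b(1) by simp
    then show ?thesis by simp
  qed
  moreover have "a \<noteq> \<one>" "a \<noteq> z"
    using a z_neq_one z_sq by auto
  ultimately show ?thesis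
    using that[of "extended_centralizer a"] a(1) b(1) extended_centralizer_proper
      extended_centralizer_subgroup
    by (auto simp: extended_centralizer_def)
next
  case False
  let ?c = "a \<otimes> b"
  have inv_c: "inv ?c = b \<otimes> a"
  proof (rule inv_equality)
    have "b \<otimes> a \<otimes> (a \<otimes> b) = b \<otimes> (a \<otimes> a) \<otimes> b"
      using a(1) b(1) by (simp add: m_assoc)
    also have "\<dots> = z \<otimes> (b \<otimes> b)"
      using a(2) b(1) z_closed z_central by (simp add: m_assoc)
    finally show "b \<otimes> a \<otimes> (a \<otimes> b) = \<one>"
      using b z_sq by simp
  qed (use a b in auto)
  have "a \<otimes> ?c = inv ?c \<otimes> a"
  proof -
    have "a \<otimes> ?c = z \<otimes> b"
      using a b by (simp flip: m_assoc)
    moreover have "inv ?c \<otimes> a = b \<otimes> z"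
      unfolding inv_c using a b by (simp add: m_assoc)
    ultimately show ?thesis using b z_central by simp
  qed
  moreover have "b \<otimes> ?c = inv ?c \<otimes> b"
    unfolding inv_c using a b by (simp add: m_assoc)
  ultimately show ?thesis
    using that[of "extended_centralizer ?c"] a b False extended_centralizer_proper[of ?c]
      extended_centralizer_subgroup[of ?c]
    by (auto simp: extended_centralizer_def)
qed

text \<open>
  If one of the three elements lay in \<open>H\<close> or \<open>HxH\<close>, or if two of them were equal, then modulo
  \<open>{1, z}\<close> the element \<open>x\<close> would commute with the involution \<open>g\<close>, or some involution would together
  with \<open>g\<close> generate a subgroup containing \<open>x\<close>. Such an involution is \<open>x\<close>, \<open>xgx\<inverse>\<close> or \<open>xg\<close>, according
  to the coincidence. Both situations confine \<open>H\<close> and \<open>x\<close> to a proper subgroup.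
\<close>

lemma order_four_extra_elements:
  assumes H: "H = {\<one>, z, g, z \<otimes> g}" "subgroup H G"
    and g: "g \<otimes> g = z"
    and x: "x \<in> carrier G" "x \<notin> H"
    and gen: "\<And>K. \<lbrakk>subgroup K G; H \<subseteq> K; x \<in> K\<rbrakk> \<Longrightarrow> K = carrier G"
    and D: "{d \<in> H. inv x \<otimes> d \<otimes> x \<in> H} \<subseteq> {\<one>, z}"
  defines "u \<equiv> x \<otimes> g \<otimes> inv x" and "v \<equiv> x \<otimes> g \<otimes> x"
  shows "distinct [u, z \<otimes> u, v]" "{u, z \<otimes> u, v} \<inter> (H \<union> (H <#> (x <#\<^bsub>G\<^esub> H))) = {}"
proof -
  note [simp] = z_closed x(1)
  have gH: "g \<in> H" and zH: "z \<in> H"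
    by (simp_all add: H(1))
  have gc [simp]: "g \<in> carrier G"
    using gH by (rule subgroup.mem_carrier[OF H(2)])
  have uc [simp]: "u \<in> carrier G" and vc [simp]: "v \<in> carrier G"
    by (simp_all add: u_def v_def)
  have Hc: "h \<in> carrier G" if "h \<in> H" for h
    using that by (rule subgroup.mem_carrier[OF H(2)])
  have Hmult: "h \<otimes> k \<in> H" if "h \<in> H" "k \<in> H" for h k
    using that H(2) by (simp add: subgroup.m_closed)
  have Hinv: "inv h \<in> H" if "h \<in> H" for h
    using that H(2) by (simp add: subgroup.m_inv_closed)
  have g_ne: "g \<noteq> \<one>" "g \<noteq> z"
    using g z_neq_one z_sq by auto
  have x_ne: "x \<noteq> \<one>" "x \<noteq> z"
    using x(2) by (auto simp: H(1))
  have gen_K: "H \<subseteq> K" if K: "subgroup K G" "g \<in> K" for K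
  proof -
    have "z \<in> K" using subgroup.m_closed[OF K(1) K(2) K(2)] g by simp
    then show ?thesis
      unfolding H(1) using K by (simp add: subgroup.m_closed subgroup.one_closed)
  qed
  have fin_K: False if "subgroup K G" "K \<noteq> carrier G" "g \<in> K" "x \<in> K" for K
    using gen[OF that(1) gen_K[OF that(1,3)] that(4)] that(2) by simp
  have no_proj_involution: False if b: "b \<in> carrier G" "b \<otimes> b = z"
    and xb: "\<And>K. \<lbrakk>subgroup K G; g \<in> K; b \<in> K\<rbrakk> \<Longrightarrow> x \<in> K" for b
  proof -
    obtain K where "subgroup K G" "K \<noteq> carrier G" "g \<in> K" "b \<in> K"
      by (rule two_projective_involutions_not_generating[OF gc g b])
    with xb fin_K show False by blast
  qed
  have x_sq: "x \<otimes> x \<noteq> z"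
    using no_proj_involution[OF x(1)] by blast
  have x_sq1: "x \<otimes> x \<noteq> \<one>"
    using square_one[OF x(1)] x_ne by blast
  have u_x: "u \<otimes> x = x \<otimes> g"
    by (simp add: u_def m_assoc)
  have uu: "u \<otimes> u = z"
  proof -
    have "u \<otimes> u = x \<otimes> (g \<otimes> (inv x \<otimes> x) \<otimes> g) \<otimes> inv x"
      unfolding u_def by (simp add: m_assoc inv_mult_cancel)
    also have "\<dots> = x \<otimes> z \<otimes> inv x"
      using g by simp
    finally show ?thesis by (simp add: z_central m_assoc)
  qed
  have uH: "u \<notin> H"
  proof
    assume "u \<in> H"
    moreover have ug: "inv x \<otimes> u \<otimes> x = g"
      by (simp add: u_def m_assoc inv_mult_cancel)
    ultimately have "u \<in> {\<one>, z}" using D gH by auto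
    then have "u \<otimes> u = \<one>" using z_sq by auto
    with uu z_neq_one show False by simp
  qed
  have u_dc: "u \<notin> H <#> (x <#\<^bsub>G\<^esub> H)"
  proof
    assume "u \<in> H <#> (x <#\<^bsub>G\<^esub> H)"
    then obtain h k where hk: "h \<in> H" "k \<in> H" "u = h \<otimes> (x \<otimes> k)"
      by (auto simp: set_mult_def l_coset_def)
    then have "x = inv h \<otimes> u \<otimes> inv k"
      using Hc by (simp add: m_assoc inv_mult_cancel)
    moreover have "inv h \<otimes> u \<otimes> inv k \<in> K" if K: "subgroup K G" "g \<in> K" "u \<in> K" for K
    proof -
      have "H \<subseteq> K" using gen_K[OF K(1,2)] .
      then have "inv h \<in> K" "inv k \<in> K"
        using hk K(1) by (auto simp: subgroup.m_inv_closed)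
      then show ?thesis using K by (simp add: subgroup.m_closed)
    qed
    ultimately have "x \<in> K" if "subgroup K G" "g \<in> K" "u \<in> K" for K
      using that by simp
    then show False by (rule no_proj_involution[OF uc uu])
  qed
  have vH: "v \<notin> H"
  proof
    assume "v \<in> H"
    then consider "v = \<one> \<or> v = z" | "v = g \<or> v = z \<otimes> g"
      unfolding H(1) by auto
    then show False
    proof cases
      case 1
      \<comment> \<open>\<open>g\<close> is a central multiple of \<open>x\<inverse>x\<inverse>\<close>, hence commutes with \<open>x\<close>\<close>
      then have cen: "y \<otimes> v = v \<otimes> y" if "y \<in> carrier G" for y
        using that z_central by auto
      have "x \<otimes> (g \<otimes> x) = x \<otimes> (x \<otimes> g)"
      proof -
        have "x \<otimes> (x \<otimes> g) \<otimes> x = x \<otimes> v"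
          by (simp add: v_def m_assoc)
        also have "\<dots> = v \<otimes> x" by (simp add: cen)
        also have "\<dots> = x \<otimes> (g \<otimes> x) \<otimes> x"
          by (simp add: v_def m_assoc)
        finally show ?thesis by simp
      qed
      then have "x \<otimes> g = g \<otimes> x" by simp
      then show False
        using fin_K[OF extended_centralizer_subgroup[OF gc] extended_centralizer_proper[OF gc g_ne]]
        by (auto simp: extended_centralizer_def)
    next
      case 2
      \<comment> \<open>modulo \<open>z\<close>, the relation \<open>xgx = g\<close> makes \<open>xg\<close> an involution\<close>
      let ?b = "x \<otimes> g"
      have "?b \<otimes> ?b = v \<otimes> g"
        by (simp add: v_def m_assoc)
      with 2 have "?b \<otimes> ?b = z \<or> ?b \<otimes> ?b = \<one>"
        using g z_sq by (auto simp: m_assoc)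
      then show False
      proof
        assume b: "?b \<otimes> ?b = z"
        have "x \<in> K" if "subgroup K G" "g \<in> K" "?b \<in> K" for K
        proof -
          have "x = ?b \<otimes> inv g" by (simp add: m_assoc)
          moreover have "?b \<otimes> inv g \<in> K"
            using that by (simp add: subgroup.m_closed subgroup.m_inv_closed)
          ultimately show ?thesis by simp
        qed
        then show False by (rule no_proj_involution[OF _ b, rotated]) simp_all
      next
        assume "?b \<otimes> ?b = \<one>"
        then have "?b \<in> H"
          using square_one[of ?b] unfolding H(1) by auto
        then have "?b \<otimes> inv g \<in> H"
          by (rule Hmult[OF _ Hinv[OF gH]])
        then show False using x by (simp add: m_assoc)
      qed
    qed
  qed
  have v_dc: "v \<notin> H <#> (x <#\<^bsub>G\<^esub> H)"
  proof
    assume "v \<in> H <#> (x <#\<^bsub>G\<^esub> H)"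
    then obtain h k where hk: "h \<in> H" "k \<in> H" "v = h \<otimes> (x \<otimes> k)"
      by (auto simp: set_mult_def l_coset_def)
    have c [simp]: "h \<in> carrier G" "k \<in> carrier G" using hk Hc by auto
    have "h \<noteq> \<one> \<and> h \<noteq> z"
    proof (rule ccontr)
      assume "\<not> (h \<noteq> \<one> \<and> h \<noteq> z)"
      then have "h \<otimes> x = x \<otimes> h"
        using z_central[OF x(1)] by auto
      then have "h \<otimes> x \<otimes> k = x \<otimes> (h \<otimes> k)"
        by (simp add: m_assoc)
      then have "x \<otimes> (g \<otimes> x) = x \<otimes> (h \<otimes> k)"
        using hk(3) by (simp add: v_def m_assoc)
      then have "g \<otimes> x = h \<otimes> k"
        by simp
      then have "x = inv g \<otimes> (h \<otimes> k)"
        by (simp add: inv_solve_left)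
      moreover have "inv g \<otimes> (h \<otimes> k) \<in> H"
        by (intro Hmult Hinv gH hk)
      ultimately show False using x(2) by simp
    qed
    moreover have "k \<noteq> \<one> \<and> k \<noteq> z"
    proof (rule ccontr)
      assume "\<not> (k \<noteq> \<one> \<and> k \<noteq> z)"
      then have "x \<otimes> k = k \<otimes> x"
        using z_central[OF x(1)] by auto
      then have "(x \<otimes> g) \<otimes> x = (h \<otimes> k) \<otimes> x"
        using hk(3) by (simp add: v_def m_assoc)
      then have "x \<otimes> g = h \<otimes> k" by simp
      then have "x = h \<otimes> k \<otimes> inv g"
        by (simp add: inv_solve_right)
      moreover have "h \<otimes> k \<otimes> inv g \<in> H"
        by (intro Hmult Hinv gH hk)
      ultimately show False using x(2) by simp
    qed
    ultimately have "(h = g \<or> h = z \<otimes> g) \<and> (k = g \<or> k = z \<otimes> g)"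
      using hk(1,2) unfolding H(1) by auto
    then obtain s\<^sub>1 s\<^sub>2 where s12: "s\<^sub>1 \<in> {\<one>, z}" "s\<^sub>2 \<in> {\<one>, z}" "h = s\<^sub>1 \<otimes> g" "k = s\<^sub>2 \<otimes> g"
      by fastforce
    define s where "s = s\<^sub>1 \<otimes> s\<^sub>2"
    have s12c [simp]: "s\<^sub>1 \<in> carrier G" "s\<^sub>2 \<in> carrier G"
      using s12 by auto
    have s: "s \<in> {\<one>, z}"
      using s12 z_sq by (auto simp: s_def)
    have "(g \<otimes> x) \<otimes> s\<^sub>2 = s\<^sub>2 \<otimes> (g \<otimes> x)"
      using s12(2) z_central[of "g \<otimes> x"] by auto
    then have "s\<^sub>1 \<otimes> ((g \<otimes> x) \<otimes> s\<^sub>2) \<otimes> g = s\<^sub>1 \<otimes> (s\<^sub>2 \<otimes> (g \<otimes> x)) \<otimes> g"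
      by simp
    then have hxk: "h \<otimes> (x \<otimes> k) = s \<otimes> (g \<otimes> (x \<otimes> g))"
      by (simp add: s12 s_def m_assoc)
    have sc [simp]: "s \<in> carrier G" using s by auto
    have s_cen: "y \<otimes> s = s \<otimes> y" if "y \<in> carrier G" for y using s that z_central by auto
    have ss: "s \<otimes> s = \<one>" using s z_sq by auto
    \<comment> \<open>The braid relation \<open>xgx = s gxg\<close> says that \<open>xg\<close> conjugates \<open>x\<close> to a central multiple of \<open>g\<close>,
      so \<open>x\<close> squares to \<open>z\<close> as \<open>g\<close> does.\<close>
    let ?b = "x \<otimes> g"
    have bx: "?b \<otimes> x = s \<otimes> (g \<otimes> ?b)"
      using hk(3) hxk by (simp add: v_def m_assoc)
    have "?b \<otimes> (x \<otimes> x) = (?b \<otimes> x) \<otimes> x"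
      by (simp add: m_assoc)
    also have "\<dots> = (s \<otimes> (g \<otimes> ?b)) \<otimes> x"
      by (simp only: bx)
    also have "\<dots> = s \<otimes> (g \<otimes> (?b \<otimes> x))"
      by (simp add: m_assoc)
    also have "\<dots> = s \<otimes> (g \<otimes> (s \<otimes> (g \<otimes> ?b)))"
      by (simp only: bx)
    also have "\<dots> = s \<otimes> ((g \<otimes> s) \<otimes> (g \<otimes> ?b))"
      by (simp add: m_assoc)
    also have "\<dots> = (s \<otimes> s) \<otimes> ((g \<otimes> g) \<otimes> ?b)"
      unfolding s_cen[OF gc] by (simp add: m_assoc)
    also have "\<dots> = ?b \<otimes> z"
      using g ss z_central[of ?b] by simp
    finally have "x \<otimes> x = z" by simp
    with x_sq show False by simp
  qed
  have "u \<noteq> v"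
  proof
    assume "u = v"
    then have "x \<otimes> g \<otimes> inv x = x \<otimes> g \<otimes> x" by (simp add: u_def v_def)
    then have "inv x = x" by simp
    then show False using x_sq1 r_inv[OF x(1)] by simp
  qed
  moreover have "z \<otimes> u \<noteq> v"
  proof
    assume "z \<otimes> u = v"
    then have "z \<otimes> (u \<otimes> x) = v \<otimes> x"
      by (simp flip: m_assoc)
    then have "z \<otimes> (x \<otimes> g) = v \<otimes> x"
      unfolding u_x .
    moreover have "(x \<otimes> g) \<otimes> z = z \<otimes> (x \<otimes> g)"
      by (rule z_central) simp
    moreover have "v \<otimes> x = (x \<otimes> g) \<otimes> (x \<otimes> x)"
      by (simp add: v_def m_assoc)
    ultimately have "(x \<otimes> g) \<otimes> z = (x \<otimes> g) \<otimes> (x \<otimes> x)"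
      by simp
    from left_cancel_eq[THEN iffD1, OF _ _ _ this] have "z = x \<otimes> x"
      by simp
    with x_sq show False by simp
  qed
  moreover have "u \<noteq> z \<otimes> u"
    using z_neq_one by simp
  ultimately show "distinct [u, z \<otimes> u, v]" by simp
  have zz: "u = z \<otimes> (z \<otimes> u)"
    using z_sq by (simp flip: m_assoc)
  have "z \<otimes> u \<notin> H" using zz uH Hmult[OF zH, of "z \<otimes> u"] by auto
  moreover have "z \<otimes> u \<notin> H <#> (x <#\<^bsub>G\<^esub> H)"
  proof
    assume "z \<otimes> u \<in> H <#> (x <#\<^bsub>G\<^esub> H)"
    then obtain h k where hk: "h \<in> H" "k \<in> H" "z \<otimes> u = h \<otimes> (x \<otimes> k)"
      by (auto simp: set_mult_def l_coset_def)
    have "u = (z \<otimes> h) \<otimes> (x \<otimes> k)"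
      using zz hk Hc by (simp add: m_assoc)
    moreover have "z \<otimes> h \<in> H" using zH hk Hmult by blast
    ultimately have "u \<in> H <#> (x <#\<^bsub>G\<^esub> H)"
      using hk by (auto simp: set_mult_def l_coset_def)
    with u_dc show False by blast
  qed
  ultimately show "{u, z \<otimes> u, v} \<inter> (H \<union> (H <#> (x <#\<^bsub>G\<^esub> H))) = {}"
    using uH u_dc vH v_dc by blast
qed

end

section \<open>Matrices of determinant one\<close>

interpretation SL2: group "SL2 :: ('a::field ^ 2 ^ 2) monoid"
  by (rule group_SL2)

lemma carrier_SL2_iff:
  "A \<in> carrier SL2 \<longleftrightarrow> A $ 1 $ 1 * A $ 2 $ 2 - A $ 1 $ 2 * A $ 2 $ 1 = 1"
  by (simp add: SL2_def det_2)

lemma mult_SL2_nth: "(A \<otimes>\<^bsub>SL2\<^esub> B) $ i $ j = A $ i $ 1 * B $ 1 $ j + A $ i $ 2 * B $ 2 $ j"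
  by (simp add: SL2_def matrix_matrix_mult_def sum_2)

lemma one_SL2_nth:
  "\<one>\<^bsub>SL2\<^esub> $ 1 $ 1 = 1" "\<one>\<^bsub>SL2\<^esub> $ 1 $ 2 = 0" "\<one>\<^bsub>SL2\<^esub> $ 2 $ 1 = 0" "\<one>\<^bsub>SL2\<^esub> $ 2 $ 2 = 1"
  by (simp_all add: SL2_def mat_def)

lemma eq_mat2_iff:
  "A = B \<longleftrightarrow> A $ 1 $ 1 = B $ 1 $ 1 \<and> A $ 1 $ 2 = B $ 1 $ 2 \<and> A $ 2 $ 1 = B $ 2 $ 1 \<and> A $ 2 $ 2 = B $ 2 $ 2"
  for A B :: "'a ^ 2 ^ 2"
  by (auto simp: vec_eq_iff forall_2)

lemma inv_SL2:
  assumes "A \<in> carrier SL2"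
  shows "inv\<^bsub>SL2\<^esub> A = vector [vector [A $ 2 $ 2, - A $ 1 $ 2], vector [- A $ 2 $ 1, A $ 1 $ 1]]"
  using assms
  by (intro SL2.inv_equality)
    (simp_all add: carrier_SL2_iff eq_mat2_iff mult_SL2_nth one_SL2_nth algebra_simps)

lemma inv_SL2_nth:
  assumes "A \<in> carrier SL2"
  shows "(inv\<^bsub>SL2\<^esub> A) $ 1 $ 1 = A $ 2 $ 2" "(inv\<^bsub>SL2\<^esub> A) $ 1 $ 2 = - A $ 1 $ 2"
    "(inv\<^bsub>SL2\<^esub> A) $ 2 $ 1 = - A $ 2 $ 1" "(inv\<^bsub>SL2\<^esub> A) $ 2 $ 2 = A $ 1 $ 1"
  by (simp_all add: inv_SL2[OF assms])

lemma neg_one_nth: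
  "(mat (- 1) :: 'a::field ^ 2 ^ 2) $ 1 $ 1 = - 1" "(mat (- 1) :: 'a ^ 2 ^ 2) $ 1 $ 2 = 0"
  "(mat (- 1) :: 'a ^ 2 ^ 2) $ 2 $ 1 = 0" "(mat (- 1) :: 'a ^ 2 ^ 2) $ 2 $ 2 = - 1"
  by (simp_all add: mat_def)

lemma scalar_in_SL2:
  assumes "A \<in> carrier SL2" "A $ 1 $ 2 = 0" "A $ 2 $ 1 = 0" "A $ 1 $ 1 = A $ 2 $ 2"
  shows "A = \<one>\<^bsub>SL2\<^esub> \<or> A = mat (- 1)"
  using assms
  by (auto simp: carrier_SL2_iff eq_mat2_iff one_SL2_nth neg_one_nth square_eq_1_iff)

text \<open>
  Conjugating by the two elementary transvections already forces a matrix which every element of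
  \<open>SL2\<close> fixes or inverts to be scalar. Matrices of order two are scalar because \<open>A\<inverse>\<close> is the adjugate
  of \<open>A\<close>, and \<open>A\<close> equals its adjugate only if it is scalar.
\<close>

lemma central_involution_SL2:
  assumes two: "(2 :: 'a::field) \<noteq> 0"
  shows "central_involution (SL2 :: ('a ^ 2 ^ 2) monoid) (mat (- 1))"
proof
  have double0: "c = 0" if "c = - c" for c :: 'a
    using that two by (metis add.right_inverse mult_2 mult_eq_0_iff)
  let ?z = "mat (- 1) :: 'a ^ 2 ^ 2"
  show "?z \<in> carrier SL2" "?z \<otimes>\<^bsub>SL2\<^esub> ?z = \<one>\<^bsub>SL2\<^esub>"
    by (simp_all add: carrier_SL2_iff eq_mat2_iff mult_SL2_nth one_SL2_nth neg_one_nth)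
  show "A \<otimes>\<^bsub>SL2\<^esub> ?z = ?z \<otimes>\<^bsub>SL2\<^esub> A" for A
    by (simp add: eq_mat2_iff mult_SL2_nth neg_one_nth)
  show "?z \<noteq> \<one>\<^bsub>SL2\<^esub>"
    using two double0[of 1] by (auto simp: eq_mat2_iff neg_one_nth one_SL2_nth)
  show "A = \<one>\<^bsub>SL2\<^esub> \<or> A = ?z" if A: "A \<in> carrier SL2" "A \<otimes>\<^bsub>SL2\<^esub> A = \<one>\<^bsub>SL2\<^esub>" for A :: "'a ^ 2 ^ 2"
  proof -
    have "inv\<^bsub>SL2\<^esub> A = A"
      using A by (intro SL2.inv_equality)
    then show ?thesis
      using inv_SL2_nth[OF A(1)] A(1) double0 by (metis scalar_in_SL2)
  qed
  fix A :: "'a ^ 2 ^ 2"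
  assume A: "A \<in> carrier SL2" "A \<noteq> \<one>\<^bsub>SL2\<^esub>" "A \<noteq> ?z"
  show "SL2.extended_centralizer A \<noteq> carrier SL2"
  proof
    assume all: "SL2.extended_centralizer A = carrier SL2"
    define t where "t = (vector [vector [1, 1], vector [0, 1]] :: 'a ^ 2 ^ 2)"
    define s where "s = (vector [vector [1, 0], vector [1, 1]] :: 'a ^ 2 ^ 2)"
    have "t \<in> SL2.extended_centralizer A" "s \<in> SL2.extended_centralizer A"
      unfolding all by (simp_all add: carrier_SL2_iff t_def s_def)
    then have t: "t \<otimes>\<^bsub>SL2\<^esub> A = A \<otimes>\<^bsub>SL2\<^esub> t \<or> t \<otimes>\<^bsub>SL2\<^esub> A = inv\<^bsub>SL2\<^esub> A \<otimes>\<^bsub>SL2\<^esub> t"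
      and s: "s \<otimes>\<^bsub>SL2\<^esub> A = A \<otimes>\<^bsub>SL2\<^esub> s \<or> s \<otimes>\<^bsub>SL2\<^esub> A = inv\<^bsub>SL2\<^esub> A \<otimes>\<^bsub>SL2\<^esub> s"
      by (auto simp: SL2.extended_centralizer_def)
    note nth = mult_SL2_nth inv_SL2_nth[OF A(1)]
    have "A $ 2 $ 1 = 0 \<and> A $ 1 $ 1 = A $ 2 $ 2"
      using t
    proof
      assume eq: "t \<otimes>\<^bsub>SL2\<^esub> A = A \<otimes>\<^bsub>SL2\<^esub> t"
      show ?thesis
        using arg_cong[OF eq, of "\<lambda>M. M $ 1 $ 1"] arg_cong[OF eq, of "\<lambda>M. M $ 1 $ 2"]
        by (simp add: nth t_def)
    next
      assume eq: "t \<otimes>\<^bsub>SL2\<^esub> A = inv\<^bsub>SL2\<^esub> A \<otimes>\<^bsub>SL2\<^esub> t"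
      have "A $ 2 $ 1 = - A $ 2 $ 1" "A $ 1 $ 1 + A $ 2 $ 1 = A $ 2 $ 2"
        using arg_cong[OF eq, of "\<lambda>M. M $ 2 $ 1"] arg_cong[OF eq, of "\<lambda>M. M $ 1 $ 1"]
        by (simp_all add: nth t_def)
      with double0[of "A $ 2 $ 1"] show ?thesis by simp
    qed
    moreover have "A $ 1 $ 2 = 0"
      using s
    proof
      assume eq: "s \<otimes>\<^bsub>SL2\<^esub> A = A \<otimes>\<^bsub>SL2\<^esub> s"
      show ?thesis
        using arg_cong[OF eq, of "\<lambda>M. M $ 1 $ 1"] by (simp add: nth s_def)
    next
      assume eq: "s \<otimes>\<^bsub>SL2\<^esub> A = inv\<^bsub>SL2\<^esub> A \<otimes>\<^bsub>SL2\<^esub> s"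
      have "A $ 1 $ 2 = - A $ 1 $ 2"
        using arg_cong[OF eq, of "\<lambda>M. M $ 1 $ 2"] by (simp add: nth s_def)
      then show ?thesis by (rule double0)
    qed
    ultimately show False
      using A scalar_in_SL2 by blast
  qed
qed

lemma upper_mult_nth:
  assumes "A \<in> upper_SL2" "B \<in> upper_SL2"
  shows "(A \<otimes>\<^bsub>SL2\<^esub> B) $ 1 $ 1 = A $ 1 $ 1 * B $ 1 $ 1"
  using assms by (simp add: upper_SL2_def mult_SL2_nth)

lemma upper_diagonal:
  assumes "A \<in> upper_SL2"
  shows "A $ 1 $ 1 * A $ 2 $ 2 = 1"
  using assms by (auto simp: upper_SL2_def carrier_SL2_iff)

text \<open>
  Conjugate matrices have the same trace, and a triangular matrix of determinant one has its two
  diagonal entries determined by the trace up to their order.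
\<close>

lemma upper_conjugate_diagonal:
  fixes A B :: "'a::field ^ 2 ^ 2"
  assumes "A \<in> upper_SL2" "B \<in> upper_SL2" "x \<in> carrier SL2"
    and "B = inv\<^bsub>SL2\<^esub> x \<otimes>\<^bsub>SL2\<^esub> A \<otimes>\<^bsub>SL2\<^esub> x"
  shows "B $ 1 $ 1 = A $ 1 $ 1 \<or> B $ 1 $ 1 = A $ 2 $ 2"
proof -
  have det: "x $ 1 $ 1 * x $ 2 $ 2 - x $ 1 $ 2 * x $ 2 $ 1 = 1"
    using assms(3) by (simp add: carrier_SL2_iff)
  have "B $ 1 $ 1 + B $ 2 $ 2 =
    (x $ 1 $ 1 * x $ 2 $ 2 - x $ 1 $ 2 * x $ 2 $ 1) * (A $ 1 $ 1 + A $ 2 $ 2)"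
    unfolding assms(4) by (simp add: mult_SL2_nth inv_SL2_nth[OF assms(3)] algebra_simps)
  then have "B $ 1 $ 1 + B $ 2 $ 2 = A $ 1 $ 1 + A $ 2 $ 2"
    by (simp add: det)
  then have "B $ 1 $ 1 * (A $ 1 $ 1 + A $ 2 $ 2) = B $ 1 $ 1 * B $ 1 $ 1 + A $ 1 $ 1 * A $ 2 $ 2"
    using upper_diagonal[OF assms(1)] upper_diagonal[OF assms(2)] by (metis distrib_left)
  then have "(B $ 1 $ 1 - A $ 1 $ 1) * (B $ 1 $ 1 - A $ 2 $ 2) = 0"
    by (simp add: algebra_simps)
  then show ?thesis by auto
qed

text \<open>
  A unipotent upper triangular matrix other than the identity fixes only one line, whereas \<open>x\<close> moves
  the line fixed by all upper triangular matrices.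
\<close>

lemma unipotent_conjugate_upper:
  fixes A :: "'a::field ^ 2 ^ 2"
  assumes "A \<in> upper_SL2" "A $ 1 $ 1 = 1" "x \<in> carrier SL2" "x \<notin> upper_SL2"
    and "inv\<^bsub>SL2\<^esub> x \<otimes>\<^bsub>SL2\<^esub> A \<otimes>\<^bsub>SL2\<^esub> x \<in> upper_SL2"
  shows "A = \<one>\<^bsub>SL2\<^esub>"
proof -
  have A22: "A $ 2 $ 2 = 1" and A21: "A $ 2 $ 1 = 0"
    using upper_diagonal[OF assms(1)] assms(1,2) by (auto simp: upper_SL2_def)
  have x21: "x $ 2 $ 1 \<noteq> 0"
    using assms(3,4) by (simp add: upper_SL2_def)
  have "(inv\<^bsub>SL2\<^esub> x \<otimes>\<^bsub>SL2\<^esub> A \<otimes>\<^bsub>SL2\<^esub> x) $ 2 $ 1 = - (A $ 1 $ 2 * x $ 2 $ 1 * x $ 2 $ 1)"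
    by (simp add: mult_SL2_nth inv_SL2_nth[OF assms(3)] assms(2) A22 A21 algebra_simps)
  then have "A $ 1 $ 2 = 0"
    using assms(5) x21 by (simp add: upper_SL2_def)
  then show ?thesis
    using assms(2) A22 A21 by (simp add: eq_mat2_iff one_SL2_nth)
qed

lemma inj_on_diagonal:
  fixes K :: "('a::field ^ 2 ^ 2) set"
  assumes K: "subgroup K SL2" "K \<subseteq> upper_SL2"
    and unipotent: "\<And>h. \<lbrakk>h \<in> K; h $ 1 $ 1 = 1\<rbrakk> \<Longrightarrow> h = \<one>\<^bsub>SL2\<^esub>"
  shows "inj_on (\<lambda>A. A $ 1 $ 1) K"
proof (rule inj_onI)
  fix a b assume ab: "a \<in> K" "b \<in> K" "a $ 1 $ 1 = b $ 1 $ 1"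
  have U: "a \<in> upper_SL2" "b \<in> upper_SL2" and c: "a \<in> carrier SL2" "b \<in> carrier SL2"
    using ab K subgroup.mem_carrier[OF K(1)] by auto
  have "(a \<otimes>\<^bsub>SL2\<^esub> inv\<^bsub>SL2\<^esub> b) $ 1 $ 1 = a $ 1 $ 1 * b $ 2 $ 2"
    using U inv_SL2_nth[OF c(2)] by (simp add: mult_SL2_nth upper_SL2_def)
  also have "\<dots> = 1"
    using upper_diagonal[OF U(2)] ab(3) by simp
  finally have "a \<otimes>\<^bsub>SL2\<^esub> inv\<^bsub>SL2\<^esub> b = \<one>\<^bsub>SL2\<^esub>"
    by (rule unipotent[OF subgroup.m_closed[OF K(1) ab(1) subgroup.m_inv_closed[OF K(1) ab(2)]]])
  then show "a = b"
    using c by (metis SL2.inv_closed SL2.inv_equality SL2.inv_inv)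
qed

text \<open>
  The powers of \<open>h\<close> exhaust the unipotent upper triangular matrices, because every element of the
  prime field is a multiple of a given nonzero one. So every fibre of the upper left entry on \<open>H\<close>
  has \<open>p\<close> elements.
\<close>

lemma card_upper_subgroup_ge:
  fixes H :: "('p::prime_card mod_ring ^ 2 ^ 2) set"
  assumes H: "subgroup H SL2" "H \<subseteq> upper_SL2"
    and h: "h \<in> H" "h $ 1 $ 1 = 1" "h \<noteq> \<one>\<^bsub>SL2\<^esub>"
  shows "CARD('p) * card ((\<lambda>A. A $ 1 $ 1) ` H) \<le> card H"
proof -
  let ?\<chi> = "\<lambda>A :: 'p mod_ring ^ 2 ^ 2. A $ 1 $ 1"
  define t where "t = (\<lambda>c. vector [vector [1, c], vector [0, 1]] :: 'p mod_ring ^ 2 ^ 2)"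
  have h22: "h $ 2 $ 2 = 1" and h21: "h $ 2 $ 1 = 0"
    using upper_diagonal[of h] H(2) h by (auto simp: upper_SL2_def)
  have h12: "h $ 1 $ 2 \<noteq> 0"
    using h h22 h21 by (auto simp: eq_mat2_iff one_SL2_nth)
  have power: "t (of_nat n * h $ 1 $ 2) \<in> H" for n
  proof (induction n)
    case 0
    have "t 0 = \<one>\<^bsub>SL2\<^esub>"
      by (simp add: t_def eq_mat2_iff one_SL2_nth)
    then show ?case using H(1) by (simp add: subgroup.one_closed)
  next
    case (Suc n)
    have "t (of_nat (Suc n) * h $ 1 $ 2) = t (of_nat n * h $ 1 $ 2) \<otimes>\<^bsub>SL2\<^esub> h"
      using h(2) h22 h21 by (simp add: t_def eq_mat2_iff mult_SL2_nth algebra_simps)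
    with Suc h(1) H(1) show ?case by (simp add: subgroup.m_closed)
  qed
  have t: "t c \<in> H" for c
  proof -
    obtain n where "c / h $ 1 $ 2 = of_nat n"
      using surj_of_nat_mod_ring by blast
    then have "c = of_nat n * h $ 1 $ 2"
      using h12 by (simp add: field_simps)
    with power show ?thesis by simp
  qed
  obtain r where r: "\<And>y. y \<in> ?\<chi> ` H \<Longrightarrow> r y \<in> H" "\<And>y. y \<in> ?\<chi> ` H \<Longrightarrow> ?\<chi> (r y) = y"
    using inv_into_into[of _ ?\<chi> H] f_inv_into_f[of _ ?\<chi> H] by metis
  have "card (UNIV \<times> ?\<chi> ` H :: ('p mod_ring \<times> 'p mod_ring) set) \<le> card H"
  proof (rule card_inj_on_le[of "\<lambda>(c, y). t c \<otimes>\<^bsub>SL2\<^esub> r y"])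
    show "inj_on (\<lambda>(c, y). t c \<otimes>\<^bsub>SL2\<^esub> r y) (UNIV \<times> ?\<chi> ` H)"
    proof (rule inj_onI, clarify)
      fix c d A B
      assume AB: "A \<in> H" "B \<in> H" and eq: "t c \<otimes>\<^bsub>SL2\<^esub> r (?\<chi> A) = t d \<otimes>\<^bsub>SL2\<^esub> r (?\<chi> B)"
      have U: "r (?\<chi> A) \<in> upper_SL2" "r (?\<chi> B) \<in> upper_SL2"
        using r AB H(2) by auto
      have "?\<chi> (t c \<otimes>\<^bsub>SL2\<^esub> r (?\<chi> A)) = ?\<chi> A" "?\<chi> (t d \<otimes>\<^bsub>SL2\<^esub> r (?\<chi> B)) = ?\<chi> B"
        using U r(2) AB by (simp_all add: mult_SL2_nth t_def upper_SL2_def)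
      with eq have \<chi>: "?\<chi> A = ?\<chi> B" by simp
      have "r (?\<chi> A) $ 2 $ 2 \<noteq> 0"
        using upper_diagonal[OF U(1)] by auto
      moreover have "c * r (?\<chi> A) $ 2 $ 2 = d * r (?\<chi> A) $ 2 $ 2"
        using arg_cong[OF eq, of "\<lambda>M. M $ 1 $ 2"] \<chi> by (simp add: mult_SL2_nth t_def)
      ultimately show "c = d \<and> ?\<chi> A = ?\<chi> B" using \<chi> by simp
    qed
  qed (use r t H(1) in \<open>auto simp: subgroup.m_closed\<close>)
  then show ?thesis by (simp add: card_cartesian_product)
qed

section \<open>Numerical estimates\<close>

text \<open>
  The letters stand for \<open>n = \<bar>H\<bar>\<close>, \<open>c = \<bar>HxH\<bar>\<close>, \<open>N = \<bar>S\<^sup>3\<bar>\<close>, \<open>s = \<bar>S\<bar>\<close> and an upper bound \<open>k\<close> of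
  \<open>\<bar>H \<inter> xHx\<inverse>\<bar>\<close>. From \<open>Nk \<ge> n(n + k)\<close> follows \<open>N\<^sup>2k\<^sup>2 \<ge> n\<^sup>2(n + k)\<^sup>2 > k\<^sup>2(n + k)\<^sup>3\<close>.
\<close>

lemma growth_arith:
  fixes n k N s c :: nat
  assumes "n + c \<le> N" "n * n \<le> c * k" "k > 0" "k * k * (n + k) < n * n" "s \<le> n + k"
  shows "s ^ 3 < N ^ 2"
proof -
  have "n * (n + k) \<le> N * k"
    using mult_right_mono[OF assms(1), of k] assms(2) by (simp add: algebra_simps)
  then have "(n * (n + k))\<^sup>2 \<le> (N * k)\<^sup>2"
    by (rule power_mono) simp
  moreover have "k * k * (n + k) ^ 3 < (n * (n + k))\<^sup>2"
  proof -
    have "(k * k * (n + k)) * (n + k)\<^sup>2 < (n * n) * (n + k)\<^sup>2"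
      using assms(3,4) by (intro mult_strict_right_mono) auto
    then show ?thesis by (simp add: power2_eq_square power3_eq_cube algebra_simps)
  qed
  ultimately have "k * k * (n + k) ^ 3 < (N * k)\<^sup>2"
    by linarith
  also have "(N * k)\<^sup>2 = k * k * N\<^sup>2"
    by (simp add: power2_eq_square)
  finally have "(n + k) ^ 3 < N\<^sup>2" by simp
  moreover have "s ^ 3 \<le> (n + k) ^ 3"
    using assms(5) by (rule power_mono) simp
  ultimately show ?thesis by linarith
qed

text \<open>
  The case \<open>k = 1\<close> is separate because \<open>x\<close> and \<open>x\<inverse>\<close> may then both be new, which makes \<open>\<bar>S\<bar>\<close> as large as
  \<open>n + 2\<close>.
\<close>

lemma growth_arith_1:
  fixes n N s :: nat
  assumes "n + n * n \<le> N" "3 \<le> n" "s \<le> n + 2"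
  shows "s ^ 3 < N ^ 2"
proof -
  have "(n + 2) ^ 3 < (n + n * n)\<^sup>2"
  proof -
    obtain m where "n = m + 3" using assms(2) by (metis add.commute le_Suc_ex)
    then show ?thesis by (simp add: power2_eq_square power3_eq_cube algebra_simps)
  qed
  moreover have "s ^ 3 \<le> (n + 2) ^ 3" "(n + n * n)\<^sup>2 \<le> N\<^sup>2"
    using assms(3,1) by (intro power_mono; simp)+
  ultimately show ?thesis by linarith
qed

lemma powr_three_halves_less:
  assumes "s ^ 3 < N ^ 2"
  shows "real s powr (3/2) < real N"
proof (cases "s = 0")
  case True
  with assms show ?thesis by (cases "N = 0") auto
next
  case False
  have "(real s powr (3/2))\<^sup>2 = real s powr 3"
    unfolding power2_eq_square by (simp flip: powr_add)
  also have "\<dots> = real s ^ 3"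
    using powr_realpow[of "real s" 3] False by simp
  also have "\<dots> < (real N)\<^sup>2"
    using assms by (metis of_nat_less_iff of_nat_power)
  finally show ?thesis by (rule power2_less_imp_less) simp
qed

section \<open>Growth of the generating set\<close>

theorem theorem5p1:
  fixes H S :: "('p::prime_card mod_ring ^ 2 ^ 2) set"
    and x :: "'p mod_ring ^ 2 ^ 2"
  assumes "CARD('p) \<ge> 5"
    and "subgroup H SL2" and "H \<subseteq> upper_SL2"
    and "x \<in> carrier SL2"
    and "S = H \<union> {x, inv\<^bsub>SL2\<^esub> x} \<or>
      (x [^]\<^bsub>SL2\<^esub> (2::nat) \<in> H \<and> S = H \<union> ((x <#\<^bsub>SL2\<^esub> H) \<inter> (H #>\<^bsub>SL2\<^esub> x)))"
    and "generate SL2 S = carrier SL2"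
  shows "real (card (S <#>\<^bsub>SL2\<^esub> S <#>\<^bsub>SL2\<^esub> S)) > real (card S) powr (3/2)"
proof -
  let ?mul = "\<lambda>a b :: 'p mod_ring ^ 2 ^ 2. a \<otimes>\<^bsub>SL2\<^esub> b"
  let ?inv = "\<lambda>a :: 'p mod_ring ^ 2 ^ 2. inv\<^bsub>SL2\<^esub> a"
  let ?one = "\<one>\<^bsub>SL2\<^esub> :: 'p mod_ring ^ 2 ^ 2"
  let ?z = "mat (- 1) :: 'p mod_ring ^ 2 ^ 2"
  let ?\<chi> = "\<lambda>A :: 'p mod_ring ^ 2 ^ 2. A $ 1 $ 1"
  let ?C = "H <#>\<^bsub>SL2\<^esub> (x <#\<^bsub>SL2\<^esub> H)"
  let ?T = "S <#>\<^bsub>SL2\<^esub> S <#>\<^bsub>SL2\<^esub> S"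
  note x = assms(4)
  have "(2 :: 'p mod_ring) \<noteq> 0"
    using of_nat_0_mod_ring_dvd[of 2, where 'a = 'p] assms(1) dvd_imp_le[of "CARD('p)" 2] by force
  then interpret Z: central_involution "SL2 :: ('p mod_ring ^ 2 ^ 2) monoid" ?z
    by (rule central_involution_SL2)
  have fin [simp]: "finite A" for A :: "('p mod_ring ^ 2 ^ 2) set"
    by (rule finite_subset[OF subset_UNIV finite])
  have H_closed: "a \<in> carrier SL2" if "a \<in> H" for a
    using that by (rule subgroup.mem_carrier[OF assms(2)])
  note H_mult = subgroup.m_closed[OF assms(2)] and H_inv = subgroup.m_inv_closed[OF assms(2)]
    and H_one = subgroup.one_closed[OF assms(2)]

  have gen: "K = carrier SL2" if K: "subgroup K SL2" "H \<subseteq> K" "x \<in> K" for K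
  proof -
    have "x <#\<^bsub>SL2\<^esub> H \<subseteq> K"
      using K by (auto simp: l_coset_def subgroup.m_closed)
    then have "S \<subseteq> K"
      using assms(5) K by (auto simp: subgroup.m_inv_closed)
    then have "carrier SL2 \<subseteq> K"
      using SL2.generate_subgroup_incl[OF _ K(1), of S] assms(6) by simp
    then show ?thesis
      using subgroup.subset[OF K(1)] by simp
  qed
  have x_upper: "x \<notin> upper_SL2"
  proof
    assume "x \<in> upper_SL2"
    then have "upper_SL2 = (carrier SL2 :: ('p mod_ring ^ 2 ^ 2) set)"
      by (rule gen[OF subgroup_upper_SL2 assms(3)])
    moreover have "vector [vector [1, 0], vector [1, 1]] \<in> (carrier SL2 :: ('p mod_ring ^ 2 ^ 2) set)"
      by (simp add: carrier_SL2_iff)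
    ultimately have "vector [vector [1, 0], vector [1, 1]] \<in> (upper_SL2 :: ('p mod_ring ^ 2 ^ 2) set)"
      by simp
    then show False
      by (simp add: upper_SL2_def)
  qed
  then have xH: "x \<notin> H"
    using assms(3) by blast

  define D where "D = {d \<in> H. ?mul (?mul (?inv x) d) x \<in> H}"
  have D_one: "?one \<in> D"
    using H_one x by (simp add: D_def)
  have double: "card H * card H \<le> card ?C * card D"
    unfolding D_def by (rule SL2.card_double_coset[OF fin assms(2) x])

  have inv_x_S: "?inv x \<in> S" and card_S: "card S \<le> card H + max 2 (card D)"
  proof -
    let ?I = "(x <#\<^bsub>SL2\<^esub> H) \<inter> (H #>\<^bsub>SL2\<^esub> x)"
    consider "S = H \<union> {x, ?inv x}" | "x [^]\<^bsub>SL2\<^esub> (2::nat) \<in> H" "S = H \<union> ?I"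
      using assms(5) by blast
    then have "?inv x \<in> S \<and> card S \<le> card H + max 2 (card D)"
    proof cases
      case 1
      have "card S \<le> card H + card {x, ?inv x}"
        unfolding 1 by (rule card_Un_le)
      moreover have "card {x, ?inv x} \<le> 2"
        by (simp add: card_insert_if)
      ultimately show ?thesis using 1 by auto
    next
      case 2
      have "?mul x x \<in> H"
        using 2(1) x by (simp add: numeral_2_eq_2)
      then have w: "?inv (?mul x x) \<in> H"
        by (rule H_inv)
      have eq: "?inv x = ?mul x (?inv (?mul x x))" "?inv x = ?mul (?inv (?mul x x)) x"
        using x by (simp_all add: SL2.inv_mult_group SL2.m_assoc flip: SL2.m_assoc[of x "?inv x"])
      have "?inv x \<in> x <#\<^bsub>SL2\<^esub> H" "?inv x \<in> H #>\<^bsub>SL2\<^esub> x"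
        unfolding l_coset_def r_coset_def using w eq by blast+
      then have "?inv x \<in> ?I" by blast
      moreover have "?I \<subseteq> (\<lambda>d. ?mul d x) ` D"
      proof
        fix y assume "y \<in> ?I"
        then obtain h d where y: "h \<in> H" "d \<in> H" "y = ?mul x h" "y = ?mul d x"
          by (auto simp: l_coset_def r_coset_def)
        have "?mul (?mul (?inv x) d) x = ?mul (?inv x) (?mul x h)"
          using y x H_closed by (simp add: SL2.m_assoc)
        also have "\<dots> = h"
          using y x H_closed by (simp add: SL2.inv_mult_cancel)
        finally have "d \<in> D"
          using y by (simp add: D_def)
        then show "y \<in> (\<lambda>d. ?mul d x) ` D"
          unfolding y(4) by (rule imageI)
      qed
      then have "card ?I \<le> card D"
        by (rule surj_card_le[OF fin])
      ultimately show ?thesis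
        using card_Un_le[of H ?I] 2(2) by auto
    qed
    then show "?inv x \<in> S" "card S \<le> card H + max 2 (card D)" by blast+
  qed
  have HS: "H \<subseteq> S"
    using assms(5) by auto
  have xS: "x \<in> S"
    using assms(5)
  proof
    assume "x [^]\<^bsub>SL2\<^esub> (2::nat) \<in> H \<and> S = H \<union> ((x <#\<^bsub>SL2\<^esub> H) \<inter> (H #>\<^bsub>SL2\<^esub> x))"
    moreover have "x = ?mul x ?one" "x = ?mul ?one x" using x by simp_all
    ultimately show ?thesis
      using H_one by (auto simp: l_coset_def r_coset_def)
  qed simp
  have triple: "?mul (?mul a b) c \<in> ?T" if "a \<in> S" "b \<in> S" "c \<in> S" for a b c
    using that by (auto simp: set_mult_def)
  have H_T: "H \<subseteq> ?T"
  proof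
    fix h assume "h \<in> H"
    then show "h \<in> ?T"
      using triple[of h ?one ?one] HS H_one H_closed by auto
  qed
  have C_T: "?C \<subseteq> ?T"
  proof
    fix y assume "y \<in> ?C"
    then obtain a b where "a \<in> H" "b \<in> H" "y = ?mul a (?mul x b)"
      by (auto simp: set_mult_def l_coset_def)
    then show "y \<in> ?T"
      using triple[of a x b] HS xS x H_closed by (auto simp: SL2.m_assoc)
  qed
  have H_C: "H \<inter> ?C = {}"
    by (rule SL2.subgroup_double_coset_disjoint[OF assms(2) x xH])
  have card_T: "card H + card ?C \<le> card ?T"
    using card_mono[OF fin, of "H \<union> ?C" ?T] H_T C_T H_C by (simp add: card_Un_disjoint)

  have \<chi>_D: "inj_on ?\<chi> D"
  proof (rule inj_on_diagonal)
    show "subgroup D SL2"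
      unfolding D_def by (rule SL2.conjugate_intersection_subgroup[OF assms(2) x])
    show "D \<subseteq> upper_SL2"
      using assms(3) by (auto simp: D_def)
    fix d assume "d \<in> D" "?\<chi> d = 1"
    then show "d = ?one"
      using unipotent_conjugate_upper[OF _ _ x x_upper, of d] assms(3) by (auto simp: D_def)
  qed
  have D_\<chi>: "card D \<le> card (?\<chi> ` H)"
    using card_image[OF \<chi>_D] card_mono[of "?\<chi> ` H" "?\<chi> ` D"] by (auto simp: D_def)
  have \<chi>_p: "card (?\<chi> ` H) < CARD('p)"
  proof -
    have "0 \<notin> ?\<chi> ` H"
      using assms(3) upper_diagonal by fastforce
    then have "?\<chi> ` H \<subset> UNIV" by auto
    then have "card (?\<chi> ` H) < CARD('p mod_ring)"
      by (rule psubset_card_mono[OF finite])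
    then show ?thesis by simp
  qed
  have D_pos: "card D \<ge> 1"
    using D_one card_gt_0_iff[of D] fin[of D] by (metis One_nat_def Suc_leI empty_iff)

  have "card S ^ 3 < card ?T ^ 2"
  proof (cases "\<exists>h \<in> H. ?\<chi> h = 1 \<and> h \<noteq> ?one")
    case True
    then have "CARD('p) * card (?\<chi> ` H) \<le> card H"
      using card_upper_subgroup_ge[OF assms(2,3)] by blast
    moreover have "(card D + 1) * card D \<le> CARD('p) * card (?\<chi> ` H)"
      using D_\<chi> \<chi>_p by (intro mult_mono) auto
    moreover have "5 * 1 \<le> CARD('p) * card (?\<chi> ` H)"
      using D_\<chi> D_pos assms(1) by (intro mult_mono) auto
    \<comment> \<open>\<open>\<bar>D\<bar> \<le> p - 1\<close> is just strong enough: \<open>\<bar>H\<bar> \<ge> (k + 1)k\<close> gives \<open>\<bar>H\<bar>\<^sup>2 \<ge> k\<^sup>2\<bar>H\<bar> + k\<bar>H\<bar>\<close>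
      with \<open>k\<bar>H\<bar> > k\<^sup>3\<close>.\<close>
    ultimately have n: "(card D + 1) * card D \<le> card H" "5 \<le> card H"
      by linarith+
    show ?thesis
    proof (cases "card D = 1")
      case True
      then show ?thesis
        using double card_T card_S n by (intro growth_arith_1[of "card H"]) auto
    next
      case False
      then have k: "card D \<ge> 2" using D_pos by simp
      have "card D * card D * (card H + card D) < card H * card H"
      proof -
        have "card D * (card D * card D) < card D * card H"
          using n(1) k by (intro mult_strict_left_mono) (auto simp: algebra_simps)
        moreover have "(card D + 1) * card D * card H \<le> card H * card H"
          using n(1) by (rule mult_right_mono) simp
        ultimately show ?thesis
          unfolding mult.assoc distrib_left distrib_right mult_1 by linarith
      qed
      then show ?thesis
        using double card_T card_S k by (intro growth_arith[of "card H" "card ?C" _ "card D"]) auto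
    qed
  next
    case False
    have \<chi>_H: "inj_on ?\<chi> H"
      using inj_on_diagonal[OF assms(2,3)] False by blast
    have comm: "?mul a b = ?mul b a" if ab: "a \<in> H" "b \<in> H" for a b
    proof -
      have "?\<chi> (?mul a b) = ?\<chi> (?mul b a)"
        using ab assms(3) by (simp add: upper_mult_nth subset_iff mult.commute)
      then show ?thesis
        using inj_onD[OF \<chi>_H] H_mult ab by blast
    qed
    have D_sub: "D \<subseteq> {?one, ?z}"
    proof
      fix d assume d: "d \<in> D"
      let ?h = "?mul (?mul (?inv x) d) x"
      have dH: "d \<in> H" and hH: "?h \<in> H" and dc: "d \<in> carrier SL2"
        using d H_closed by (auto simp: D_def)
      have xh: "?mul x ?h = ?mul d x"
        using x dc SL2.inv_mult_cancel[of "?inv x" "?mul d x"] by (simp add: SL2.m_assoc)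
      have "?\<chi> ?h = ?\<chi> d \<or> ?\<chi> ?h = ?\<chi> (?inv d)"
        using upper_conjugate_diagonal[OF _ _ x refl, of d] dH hH assms(3) inv_SL2_nth(1)[OF dc]
        by auto
      then have "?h = d \<or> ?h = ?inv d"
        using inj_onD[OF \<chi>_H] dH hH H_inv by blast
      then have "?mul x d = ?mul d x \<or> ?mul x d = ?mul (?inv d) x"
      proof
        assume "?h = d"
        with xh show ?thesis by simp
      next
        assume "?h = ?inv d"
        with xh have "?mul x (?inv d) = ?mul d x" by simp
        then have "?mul (?mul (?inv d) (?mul x (?inv d))) d = ?mul (?mul (?inv d) (?mul d x)) d"
          by simp
        then show ?thesis
          using x dc by (simp add: SL2.m_assoc SL2.inv_mult_cancel)
      qed
      then have "x \<in> SL2.extended_centralizer d"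
        using x by (simp add: SL2.extended_centralizer_def)
      moreover have "H \<subseteq> SL2.extended_centralizer d"
        using comm dH H_closed by (auto simp: SL2.extended_centralizer_def)
      ultimately have "SL2.extended_centralizer d = carrier SL2"
        using gen[OF SL2.extended_centralizer_subgroup[OF dc]] by blast
      then show "d \<in> {?one, ?z}"
        using Z.extended_centralizer_proper[OF dc] by blast
    qed
    have "\<not> H \<subseteq> {?one, ?z}"
    proof
      assume central: "H \<subseteq> {?one, ?z}"
      have "SL2.extended_centralizer x = carrier SL2"
      proof (rule gen[OF SL2.extended_centralizer_subgroup[OF x]])
        show "H \<subseteq> SL2.extended_centralizer x"
          using central x Z.z_closed Z.z_central[OF x]
          by (auto simp: SL2.extended_centralizer_def)
        show "x \<in> SL2.extended_centralizer x"
          using x by (simp add: SL2.extended_centralizer_def)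
      qed
      then have "x = ?one \<or> x = ?z"
        using Z.extended_centralizer_proper[OF x] by blast
      then show False
        using x_upper x by (auto simp: upper_SL2_def one_SL2_nth neg_one_nth)
    qed
    then obtain g where g: "g \<in> H" "g \<noteq> ?one" "g \<noteq> ?z"
      by blast
    have gc: "g \<in> carrier SL2" using g(1) by (rule H_closed)
    have g_inv: "?inv g \<noteq> g" "?inv g \<noteq> ?one" "?inv g \<noteq> ?z"
    proof -
      show "?inv g \<noteq> g"
        using Z.square_one[OF gc] SL2.r_inv[OF gc] g by auto
      have "?inv ?z = ?z"
        by (rule SL2.inv_equality[OF Z.z_sq]) (use Z.z_closed in auto)
      then show "?inv g \<noteq> ?one" "?inv g \<noteq> ?z"
        using g gc by (metis SL2.inv_inv SL2.inv_one)+
    qed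
    show ?thesis
    proof (cases "?z \<in> H")
      case False
      then have "D = {?one}"
        using D_sub D_one by (auto simp: D_def)
      then have "card D = 1" by simp
      moreover have "card {?one, g, ?inv g} \<le> card H"
        using g(1) H_one H_inv by (intro card_mono) auto
      moreover have "card {?one, g, ?inv g} = 3"
        using g g_inv by auto
      ultimately show ?thesis
        using double card_T card_S by (intro growth_arith_1[of "card H"]) auto
    next
      case zH: True
      have "card D \<le> card {?one, ?z}"
        using D_sub by (intro card_mono) auto
      then have D2: "card D \<le> 2"
        using Z.z_neq_one by auto
      then have double2: "card H * card H \<le> card ?C * 2"
        using double by (meson mult_le_mono2 order_trans)
      have z_move: "?mul ?z (?mul ?z a) = a" if "a \<in> carrier SL2" for a
        using that Z.z_closed Z.z_sq by (simp flip: SL2.m_assoc)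
      have z_ne: "?mul ?z a \<noteq> a" "?mul ?z a = ?mul ?z b \<longleftrightarrow> a = b" "?mul ?z a = b \<longleftrightarrow> a = ?mul ?z b"
        if "a \<in> carrier SL2" "b \<in> carrier SL2" for a b
        using that Z.z_closed Z.z_neq_one z_move by (auto simp: SL2.left_cancel_eq)
      have z_g: "?mul ?z g \<noteq> ?one" "?mul ?z g \<noteq> ?z"
        using z_ne(3)[OF gc SL2.one_closed] z_ne(3)[OF gc Z.z_closed] g Z.z_sq Z.z_closed by auto
      let ?F = "{?one, ?z, g, ?mul ?z g}"
      have F: "?F \<subseteq> H"
        using H_one zH g(1) H_mult by auto
      have card_F: "card ?F = 4"
        using g z_g z_ne(1)[OF gc gc] Z.z_neq_one by auto
      show ?thesis
      proof (cases "H = ?F")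
        case False
        then obtain h where h: "h \<in> H" "h \<notin> ?F"
          using F by blast
        have hc: "h \<in> carrier SL2" using h(1) by (rule H_closed)
        have zh: "?mul ?z h \<notin> ?F"
        proof
          assume "?mul ?z h \<in> ?F"
          then have "?mul ?z (?mul ?z h) \<in> (\<lambda>a. ?mul ?z a) ` ?F" by blast
          also have "\<dots> \<subseteq> ?F"
            using z_move[OF gc] Z.z_closed Z.z_sq by auto
          finally show False using h(2) z_move[OF hc] by simp
        qed
        \<comment> \<open>Five elements would not suffice for the estimate, so both \<open>h\<close> and \<open>-h\<close> are needed.\<close>
        have "card ({h, ?mul ?z h} \<union> ?F) = card {h, ?mul ?z h} + card ?F"
          using h(2) zh by (intro card_Un_disjoint) auto
        moreover have "card {h, ?mul ?z h} = 2"
          using z_ne(1)[OF hc hc] by auto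
        moreover have "card ({h, ?mul ?z h} \<union> ?F) \<le> card H"
          using F h(1) H_mult[OF zH h(1)] by (intro card_mono) auto
        ultimately have n: "6 \<le> card H"
          using card_F by linarith
        then have "6 * card H \<le> card H * card H" by simp
        moreover have "2 * 2 * (card H + 2) < 6 * card H"
          using n by simp
        ultimately have "2 * 2 * (card H + 2) < card H * card H"
          by (rule less_le_trans[rotated])
        then show ?thesis
          using double2 card_T card_S D2
          by (intro growth_arith[of "card H" "card ?C" _ 2]) auto
      next
        case True
        have "?inv g \<in> H" using g(1) by (rule H_inv)
        then have "?inv g = ?mul ?z g"
          using g_inv True by blast
        then have "?mul ?z (?mul g g) = ?one"
          using SL2.l_inv[OF gc] gc Z.z_closed by (simp add: SL2.m_assoc)
        then have gg: "?mul g g = ?z"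
          using z_ne(3)[of "?mul g g" ?one] gc Z.z_closed by simp
        define u where "u = ?mul (?mul x g) (?inv x)"
        define v where "v = ?mul (?mul x g) x"
        note extra = Z.order_four_extra_elements[OF True assms(2) gg x xH gen
            D_sub[unfolded D_def], folded u_def v_def]
        have "?mul ?z u = ?mul (?mul x (?mul ?z g)) (?inv x)"
          using Z.z_central[OF x] x gc Z.z_closed
          by (simp add: u_def flip: SL2.m_assoc)
        then have "{u, ?mul ?z u, v} \<subseteq> ?T"
          using triple[OF xS _ inv_x_S] triple[OF xS _ xS] HS g(1) H_mult[OF zH g(1)]
          by (auto simp: u_def v_def)
        then have "card ({u, ?mul ?z u, v} \<union> (H \<union> ?C)) \<le> card ?T"
          using H_T C_T by (intro card_mono) auto
        moreover have "card ({u, ?mul ?z u, v} \<union> (H \<union> ?C)) = card {u, ?mul ?z u, v} + (card H + card ?C)"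
          using extra(2) H_C by (simp add: card_Un_disjoint del: Un_insert_left)
        moreover have "card {u, ?mul ?z u, v} = 3"
          using extra(1) by auto
        moreover have "card H = 4" using card_F True by simp
        ultimately have "15 \<le> card ?T" "card S \<le> 6"
          using double2 card_S D2 by auto
        then have "card S ^ 3 \<le> 6 ^ 3" "15 ^ 2 \<le> card ?T ^ 2"
          by (intro power_mono; simp)+
        then show ?thesis by simp
      qed
    qed
  qed
  then show ?thesis by (rule powr_three_halves_less)
qed

end
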